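(* Let $(X,\trianglelefteq)$ be a parallel ordered locale whose localic cones preserve joins. Then for all $U,A,B,W\in\mathcal{O}X$ the causal coverages $\mathrm{Cov}^{\pm}_{\trianglelefteq}$ have the following properties (a statement with $\pm$ holds for each of the two signs): (a) $U\in\mathrm{Cov}^{\pm}_{\trianglelefteq}(U)$; (b) $\Downarrow U\in\mathrm{Cov}^{-}_{\trianglelefteq}(U)$ and $\Uparrow U\in\mathrm{Cov}^{+}_{\trianglelefteq}(U)$; (c) if $B\in\mathrm{Cov}^{\pm}_{\trianglelefteq}(A)$ and $A\in\mathrm{Cov}^{\pm}_{\trianglelefteq}(U)$, then $B\in\mathrm{Cov}^{\pm}_{\trianglelefteq}(U)$; (d$^-$) if $A\in\mathrm{Cov}^{-}_{\trianglelefteq}(U)$ and $W\sqsubseteq U$, then $A\wedge\Downarrow W\in\mathrm{Cov}^{-}_{\trianglelefteq}(W)$; (d$^+$) if $B\in\mathrm{Cov}^{+}_{\trianglelefteq}(U)$ and $W\sqsubseteq U$, then $B\wedge\Uparrow W\in\mathrm{Cov}^{+}_{\trianglelefteq}(W)$; (e) if $A\in\mathrm{Cov}^{-}_{\trianglelefteq}(U)$ then $A\trianglelefteq U$, and if $B\in\mathrm{Cov}^{+}_{\trianglelefteq}(U)$ then $U\trianglelefteq B$; (f) $\mathrm{Cov}^{\pm}_{\trianglelefteq}(\varnothing)=\{\varnothing\}$.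
   Context: A locale $X$ is given by its frame of opens $\mathcal{O}X$ with order $\sqsubseteq$, finite meets $\wedge$, joins $\bigvee$, bottom element $\varnothing$. An ordered locale $(X,\trianglelefteq)$ is a locale $X$ with a preorder $\trianglelefteq$ on $\mathcal{O}X$ such that $U_i\trianglelefteq V_i$ for all $i\in I$ implies $\bigvee_i U_i\trianglelefteq\bigvee_i V_i$. Its localic cones are $\Uparrow U:=\bigvee\{V: U\trianglelefteq V\}$ and $\Downarrow U:=\bigvee\{W: W\trianglelefteq U\}$. The localic cones preserve joins if $\Uparrow\bigvee_i U_i=\bigvee_i\Uparrow U_i$ and $\Downarrow\bigvee_i U_i=\bigvee_i\Downarrow U_i$ for all families. The ordered locale is parallel ordered if: $(\wedge^+)$ whenever $U\sqsubseteq V\trianglelefteq V'$ there is $U'$ with $U\trianglelefteq U'\sqsubseteq V'$; $(\wedge^-)$ whenever $V\trianglelefteq V'$ and $U'\sqsubseteq V'$ there is $U$ with $U\sqsubseteq V$ and $U\trianglelefteq U'$; $(\varnothing)$ $U\trianglelefteq\varnothing\trianglelefteq V$ implies $U=\varnothing=V$. A path is a finite sequence $p=(p_n)_{n=0}^N$ of non-empty opens (steps) with $p_n\trianglelefteq p_{n+1}$ for $0\le n<N$; its starting point is $p_\bot=p_0$, its endpoint is $p_\top=p_N$. It inhabits $V$ if $p_n\sqsubseteq V$ for some $n$; it lands in $V$ if $p_\top\sqsubseteq V$; it starts in $V$ if $p_\bot\sqsubseteq V$. A path $q$ refines $p$, written $q\Subset p$, if for every $n$ there is $m$ with $q_m\sqsubseteq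 p_n$. For $W\sqsubseteq p_N$ the restriction $p|_W$ is defined by $(p|_W)_N:=W$ and $(p|_W)_n:=p_n\wedge\Downarrow(p|_W)_{n+1}$ for $0\le n<N$. Dually for $V\sqsubseteq p_0$, $p|^V$ is defined by $(p|^V)_0:=V$, $(p|^V)_{n+1}:=p_{n+1}\wedge\Uparrow(p|^V)_n$. A local past refinement of $p$ is a family $(q^j)_{j\in J}$ of paths with $\bigvee_j q^j_\top=p_\top$ and $q^j\Subset p|_{q^j_\top}$ for all $j$; a local future refinement is a family with $\bigvee_j q^j_\bot=p_\bot$ and $q^j\Subset p|^{q^j_\bot}$ for all $j$. $A$ covers $U$ from below, $A\in\mathrm{Cov}^-_{\trianglelefteq}(U)$, if $A\sqsubseteq\Downarrow U$ and every path $p$ landing in $U$ has a local past refinement $(q^j)$ such that each $q^j$ inhabits $A$. $A$ covers $U$ from above, $A\in\mathrm{Cov}^+_{\trianglelefteq}(U)$, if $A\sqsubseteq\Uparrow U$ and every path $p$ starting in $U$ has a local future refinement $(q^j)$ such that each $q^j$ inhabits $A$. *)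

theory Defs
  imports Main
begin

text \<open>
  The library's \<open>complete_distrib_lattice\<close> requires the full infinite choice-style distributive
  law, which a frame need not satisfy; a frame only has binary meets distributing over all joins.
  A type of this class plays the role of the frame of opens of a locale.
\<close>

class frame = complete_lattice +
  assumes inf_Sup_distrib: "inf x (Sup A) = (SUP a\<in>A. inf x a)"

text \<open>
  A family of related pairs is represented by the set of its pairs; \<open>SUP_related\<close> below
  recovers families over index sets of arbitrary type.
\<close>

locale ordered_locale =
  fixes le :: "'a::frame \<Rightarrow> 'a \<Rightarrow> bool" (infix "\<unlhd>" 50)
  assumes refl: "U \<unlhd> U"
    and trans: "U \<unlhd> V \<Longrightarrow> V \<unlhd> W \<Longrightarrow> U \<unlhd> W"
    and Sup_related: "(\<And>U V. (U, V) \<in> R \<Longrightarrow> U \<unlhd> V) \<Longrightarrow> Sup (fst ` R) \<unlhd> Sup (snd ` R)"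
begin

lemma SUP_related:
  assumes "\<And>i. i \<in> I \<Longrightarrow> U i \<unlhd> V i"
  shows "(SUP i\<in>I. U i) \<unlhd> (SUP i\<in>I. V i)"
  using Sup_related[of "(\<lambda>i. (U i, V i)) ` I"] assms by (auto simp: image_image)

end

locale parallel_ordered_locale = ordered_locale +
  assumes wedge_future: "U \<le> V \<Longrightarrow> V \<unlhd> V' \<Longrightarrow> \<exists>U'. U \<unlhd> U' \<and> U' \<le> V'"
    and wedge_past: "V \<unlhd> V' \<Longrightarrow> U' \<le> V' \<Longrightarrow> \<exists>U. U \<le> V \<and> U \<unlhd> U'"
    and empty_related: "U \<unlhd> bot \<Longrightarrow> bot \<unlhd> V \<Longrightarrow> U = bot \<and> V = bot"

definition future_cone :: "('a::frame \<Rightarrow> 'a \<Rightarrow> bool) \<Rightarrow> 'a \<Rightarrow> 'a" where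
  "future_cone le U = Sup {V. le U V}"

definition past_cone :: "('a::frame \<Rightarrow> 'a \<Rightarrow> bool) \<Rightarrow> 'a \<Rightarrow> 'a" where
  "past_cone le U = Sup {W. le W U}"

definition cones_preserve_joins :: "('a::frame \<Rightarrow> 'a \<Rightarrow> bool) \<Rightarrow> bool" where
  "cones_preserve_joins le \<longleftrightarrow>
     (\<forall>S. future_cone le (Sup S) = (SUP U\<in>S. future_cone le U)) \<and>
     (\<forall>S. past_cone le (Sup S) = (SUP U\<in>S. past_cone le U))"

text \<open>
  A path \<open>(p\<^sub>0, \<dots>, p\<^sub>N)\<close> is the list of its \<open>N + 1\<close> steps, so its starting point
  is \<open>hd p\<close> and its endpoint is \<open>last p\<close>.
\<close>

definition is_path :: "('a::frame \<Rightarrow> 'a \<Rightarrow> bool) \<Rightarrow> 'a list \<Rightarrow> bool" where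
  "is_path le p \<longleftrightarrow> p \<noteq> [] \<and> (\<forall>n < length p. p ! n \<noteq> bot) \<and>
     (\<forall>n. Suc n < length p \<longrightarrow> le (p ! n) (p ! Suc n))"

definition inhabits :: "'a::frame list \<Rightarrow> 'a \<Rightarrow> bool" where
  "inhabits p V \<longleftrightarrow> (\<exists>n < length p. p ! n \<le> V)"

definition lands_in :: "'a::frame list \<Rightarrow> 'a \<Rightarrow> bool" where
  "lands_in p V \<longleftrightarrow> last p \<le> V"

definition starts_in :: "'a::frame list \<Rightarrow> 'a \<Rightarrow> bool" where
  "starts_in p V \<longleftrightarrow> hd p \<le> V"

definition refines :: "'a::frame list \<Rightarrow> 'a list \<Rightarrow> bool" where
  "refines q p \<longleftrightarrow> (\<forall>n < length p. \<exists>m < length q. q ! m \<le> p ! n)"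

text \<open>
  \<open>past_restrict le p W\<close> is \<open>p|\<^sub>W\<close> and \<open>future_restrict le p V\<close> is \<open>p|\<^sup>V\<close>; they are
  meaningful for \<open>W \<le> last p\<close> and \<open>V \<le> hd p\<close>. The indexed recursions characterizing them
  are the \<open>nth\<close> lemmas below.
\<close>

fun past_restrict :: "('a::frame \<Rightarrow> 'a \<Rightarrow> bool) \<Rightarrow> 'a list \<Rightarrow> 'a \<Rightarrow> 'a list" where
  "past_restrict le [] W = []"
| "past_restrict le [x] W = [W]"
| "past_restrict le (x # y # ys) W =
     (let r = past_restrict le (y # ys) W in inf x (past_cone le (hd r)) # r)"

fun future_restrict :: "('a::frame \<Rightarrow> 'a \<Rightarrow> bool) \<Rightarrow> 'a list \<Rightarrow> 'a \<Rightarrow> 'a list" where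
  "future_restrict le [] V = []"
| "future_restrict le [x] V = [V]"
| "future_restrict le (x # y # ys) V =
     V # future_restrict le (y # ys) (inf y (future_cone le V))"

lemma length_past_restrict [simp]: "length (past_restrict le p W) = length p"
  by (induction le p W rule: past_restrict.induct) (auto simp: Let_def)

lemma length_future_restrict [simp]: "length (future_restrict le p V) = length p"
  by (induction le p V rule: future_restrict.induct) auto

lemma past_restrict_nth_last:
  "p \<noteq> [] \<Longrightarrow> past_restrict le p W ! (length p - 1) = W"
  by (induction le p W rule: past_restrict.induct) (auto simp: Let_def)

lemma past_restrict_nth:
  "Suc n < length p \<Longrightarrow>
     past_restrict le p W ! n = inf (p ! n) (past_cone le (past_restrict le p W ! Suc n))"
proof (induction le p W arbitrary: n rule: past_restrict.induct)
  case (3 le x y ys W)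
  have "past_restrict le (y # ys) W \<noteq> []"
    by (metis length_past_restrict length_0_conv list.distinct(1))
  with 3 show ?case by (cases n) (auto simp: Let_def hd_conv_nth)
qed auto

lemma future_restrict_nth_0: "p \<noteq> [] \<Longrightarrow> future_restrict le p V ! 0 = V"
  by (induction le p V rule: future_restrict.induct) auto

lemma future_restrict_nth_Suc:
  "Suc n < length p \<Longrightarrow>
     future_restrict le p V ! Suc n = inf (p ! Suc n) (future_cone le (future_restrict le p V ! n))"
proof (induction le p V arbitrary: n rule: future_restrict.induct)
  case (3 le x y ys V)
  then show ?case by (cases n) (auto simp: future_restrict_nth_0)
qed auto

text \<open>
  A family of paths enters only through the set of its members, so families are rendered as sets.
\<close>

definition local_past_refinement ::
    "('a::frame \<Rightarrow> 'a \<Rightarrow> bool) \<Rightarrow> 'a list \<Rightarrow> 'a list set \<Rightarrow> bool" where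
  "local_past_refinement le p Q \<longleftrightarrow>
     (\<forall>q\<in>Q. is_path le q) \<and> (SUP q\<in>Q. last q) = last p \<and>
     (\<forall>q\<in>Q. refines q (past_restrict le p (last q)))"

definition local_future_refinement ::
    "('a::frame \<Rightarrow> 'a \<Rightarrow> bool) \<Rightarrow> 'a list \<Rightarrow> 'a list set \<Rightarrow> bool" where
  "local_future_refinement le p Q \<longleftrightarrow>
     (\<forall>q\<in>Q. is_path le q) \<and> (SUP q\<in>Q. hd q) = hd p \<and>
     (\<forall>q\<in>Q. refines q (future_restrict le p (hd q)))"

definition Cov_past :: "('a::frame \<Rightarrow> 'a \<Rightarrow> bool) \<Rightarrow> 'a \<Rightarrow> 'a set" where
  "Cov_past le U = {A. A \<le> past_cone le U \<and>
     (\<forall>p. is_path le p \<and> lands_in p U \<longrightarrow>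
        (\<exists>Q. local_past_refinement le p Q \<and> (\<forall>q\<in>Q. inhabits q A)))}"

definition Cov_future :: "('a::frame \<Rightarrow> 'a \<Rightarrow> bool) \<Rightarrow> 'a \<Rightarrow> 'a set" where
  "Cov_future le U = {A. A \<le> future_cone le U \<and>
     (\<forall>p. is_path le p \<and> starts_in p U \<longrightarrow>
        (\<exists>Q. local_future_refinement le p Q \<and> (\<forall>q\<in>Q. inhabits q A)))}"

end

(*
  All parts except transitivity follow directly from the definitions; the future half is the past
  half for the opposite order. The difficulty in (c) is that a refinement q of p may visit the
  steps of p in a different order, so that shrinking the endpoint of q need not preserve the
  refinement. The property that does compose is the weaker one in which q only refines p, not its
  restriction to the endpoint of q, so the point is that this weak property already gives a
  covering.

  Label the steps of p by 0, ..., N, and call an endpoint good if it is the endpoint of a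
  refinement of the required kind. Suppose the join of all good endpoints is not the endpoint of p.
  Among the paths whose endpoint is still not below that join, choose ones whose steps can be
  continued, through steps of p, to visit as many words of labels as possible; there are only
  finitely many words without repetition, so maximal choices exist. They are made successively for
  the initial segments of labels, from the longest to the shortest. A weak refinement s of the
  resulting path visits the labels in some order, and by maximality every label it visits can be
  continued along the remaining word. Joining s with all these continuations yields a path along
  the same word whose endpoint contains every witness needed to make it a refinement of the
  restriction of p to that endpoint. So the endpoint of s is good after all.
*)

theory Submission
  imports Defs
begin

section \<open>Paths and refinement through list membership\<close>

lemma is_path_iff: "is_path le p \<longleftrightarrow> p \<noteq> [] \<and> bot \<notin> set p \<and> successively le p"
  unfolding is_path_def successively_conv_nth by (metis in_set_conv_nth)

lemma refines_iff: "refines q p \<longleftrightarrow> (\<forall>x\<in>set p. \<exists>y\<in>set q. y \<le> x)"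
  unfolding refines_def by (metis in_set_conv_nth)

lemma inhabits_iff: "inhabits q V \<longleftrightarrow> (\<exists>y\<in>set q. y \<le> V)"
  unfolding inhabits_def by (metis in_set_conv_nth)

lemma refines_trans: "refines r q \<Longrightarrow> refines q p \<Longrightarrow> refines r p"
  unfolding refines_iff by (meson order_trans)

text \<open>Collects the hypotheses of the theorem in one context, so that the future half comes
  from interpreting it at the opposite order.\<close>

locale join_preserving_locale = parallel_ordered_locale +
  assumes preserve: "cones_preserve_joins (\<unlhd>)"
begin

abbreviation past :: "'a \<Rightarrow> 'a" where "past \<equiv> past_cone (\<unlhd>)"
abbreviation future :: "'a \<Rightarrow> 'a" where "future \<equiv> future_cone (\<unlhd>)"
abbreviation path :: "'a list \<Rightarrow> bool" where "path \<equiv> is_path (\<unlhd>)"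
abbreviation restrict :: "'a list \<Rightarrow> 'a \<Rightarrow> 'a list" where "restrict \<equiv> past_restrict (\<unlhd>)"

section \<open>The localic cones\<close>

lemma past_Sup: "past (Sup S) = (SUP U\<in>S. past U)"
  and future_Sup: "future (Sup S) = (SUP U\<in>S. future U)"
  using preserve unfolding cones_preserve_joins_def by auto

lemma past_bot [simp]: "past bot = bot" and future_bot [simp]: "future bot = bot"
  using past_Sup[of "{}"] future_Sup[of "{}"] by auto

lemma past_mono: "x \<le> y \<Longrightarrow> past x \<le> past y"
  using past_Sup[of "{x, y}"] by (simp add: sup.absorb2 le_iff_sup)

lemma future_mono: "x \<le> y \<Longrightarrow> future x \<le> future y"
  using future_Sup[of "{x, y}"] by (simp add: sup.absorb2 le_iff_sup)

text \<open>All opens \<open>W\<close> with \<open>W \<unlhd> x\<close> are joined against the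
  constant family \<open>x\<close>; reflexivity makes the family nonempty, so its second join is
  \<open>x\<close>.\<close>

lemma past_related: "past x \<unlhd> x"
proof -
  have "{W. W \<unlhd> x} \<noteq> {}" using refl by blast
  then show ?thesis
    using SUP_related[of "{W. W \<unlhd> x}" "\<lambda>W. W" "\<lambda>_. x"] by (simp add: past_cone_def)
qed

lemma future_related: "x \<unlhd> future x"
proof -
  have "{V. x \<unlhd> V} \<noteq> {}" using refl by blast
  then show ?thesis
    using SUP_related[of "{V. x \<unlhd> V}" "\<lambda>_. x" "\<lambda>V. V"] by (simp add: future_cone_def)
qed

lemma related_past: "x \<unlhd> y \<Longrightarrow> x \<le> past y"
  unfolding past_cone_def by (auto intro: Sup_upper)

lemma related_future: "x \<unlhd> y \<Longrightarrow> y \<le> future x"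
  unfolding future_cone_def by (auto intro: Sup_upper)

lemma past_increasing: "x \<le> past x" and future_increasing: "x \<le> future x"
  using related_past related_future refl by auto

lemma past_past: "past (past x) \<le> past x" and future_future: "future (future x) \<le> future x"
  by (meson related_past past_related trans) (meson related_future future_related trans)

lemma past_trans: "x \<le> past y \<Longrightarrow> y \<le> past z \<Longrightarrow> x \<le> past z"
  by (meson order_trans past_mono past_past)

text \<open>The wedge axioms produce \<open>x \<unlhd> y'\<close> with \<open>y' \<le> y\<close> and
  \<open>x' \<unlhd> y\<close> with \<open>x' \<le> x\<close>; joining the two pairs gives the
  claim. So the order is determined by its cones.\<close>

lemma relatedI:
  assumes "x \<le> past y" "y \<le> future x"
  shows "x \<unlhd> y"
proof -
  obtain y' where y': "x \<unlhd> y'" "y' \<le> y"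
    using wedge_future[OF assms(1) past_related] by auto
  obtain x' where x': "x' \<le> x" "x' \<unlhd> y"
    using wedge_past[OF future_related assms(2)] by auto
  show ?thesis
    using Sup_related[of "{(x, y'), (x', y)}"] x' y' by (auto simp: sup.absorb1 sup.absorb2)
qed

lemma related_iff: "x \<unlhd> y \<longleftrightarrow> x \<le> past y \<and> y \<le> future x"
  using relatedI related_past related_future by blast

lemma related_inf_future:
  assumes "x \<le> past y"
  shows "x \<unlhd> inf y (future x)"
proof (rule relatedI)
  obtain y' where y': "x \<unlhd> y'" "y' \<le> y"
    using wedge_future[OF assms past_related] by auto
  then have "y' \<le> inf y (future x)"
    by (simp add: related_future)
  then show "x \<le> past (inf y (future x))"
    using y'(1) past_mono related_past order_trans by meson
qed auto

lemma related_inf_past: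
  assumes "y \<le> future x"
  shows "inf x (past y) \<unlhd> y"
proof (rule relatedI)
  obtain x' where x': "x' \<le> x" "x' \<unlhd> y"
    using wedge_past[OF future_related assms] by auto
  then have "x' \<le> inf x (past y)"
    by (simp add: related_past)
  then show "y \<le> future (inf x (past y))"
    using x'(2) future_mono related_future order_trans by meson
qed auto

text \<open>Both cones of \<open>bot\<close> are \<open>bot\<close>, as they preserve the empty
  join, and each member of a related pair lies in a cone of the other.\<close>

lemma related_bot_iff: "x \<unlhd> y \<Longrightarrow> x = bot \<longleftrightarrow> y = bot"
  by (metis related_iff past_bot future_bot bot.extremum_uniqueI)

section \<open>Paths and their restrictions\<close>

lemma path_Cons: "path (x # q) \<longleftrightarrow> x \<noteq> bot \<and> (q = [] \<or> x \<unlhd> hd q \<and> path q)"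
  by (auto simp: is_path_iff successively_Cons)

lemma path_append:
  "xs \<noteq> [] \<Longrightarrow> ys \<noteq> [] \<Longrightarrow>
    path (xs @ ys) \<longleftrightarrow> path xs \<and> path ys \<and> last xs \<unlhd> hd ys"
  by (auto simp: is_path_iff successively_append_iff)

lemma path_nth_related:
  assumes "path p" "i \<le> j" "j < length p"
  shows "p ! i \<unlhd> p ! j"
proof (cases "i = j")
  case False
  have "sorted_wrt (\<unlhd>) p"
    using assms(1) trans by (auto simp: is_path_iff successively_iff_sorted_wrt_strong)
  then show ?thesis
    using False assms sorted_wrt_nth_less by fastforce
qed (simp add: refl)

lemma path_nth_not_bot: "path p \<Longrightarrow> i < length p \<Longrightarrow> p ! i \<noteq> bot"
  by (simp add: is_path_def)

lemma path_not_Nil: "path p \<Longrightarrow> p \<noteq> []"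
  by (simp add: is_path_def)

lemma path_last_not_bot: "path p \<Longrightarrow> last p \<noteq> bot"
  by (metis is_path_iff last_in_set)

lemma path_drop: "path p \<Longrightarrow> n < length p \<Longrightarrow> path (drop n p)"
  by (auto simp: is_path_def)

lemma path_take: "path p \<Longrightarrow> 0 < n \<Longrightarrow> path (take n p)"
  by (auto simp: is_path_def)

lemma restrict_Nil_iff [simp]: "restrict p W = [] \<longleftrightarrow> p = []"
  by (metis length_0_conv length_past_restrict)

lemma last_restrict: "p \<noteq> [] \<Longrightarrow> last (restrict p W) = W"
  by (metis last_conv_nth length_past_restrict past_restrict_nth_last restrict_Nil_iff)

lemma restrict_nth_le:
  "W \<le> last p \<Longrightarrow> n < length p \<Longrightarrow> restrict p W ! n \<le> p ! n"
proof (cases "Suc n < length p")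
  case False
  assume "W \<le> last p" "n < length p"
  with False have "n = length p - 1" "p \<noteq> []" by auto
  then show ?thesis using \<open>W \<le> last p\<close> by (metis past_restrict_nth_last last_conv_nth)
qed (simp add: past_restrict_nth)

text \<open>From the end backwards: a restricted step stays in the future cone of the preceding step
  of \<open>p\<close>, so meeting that step with the past cone gives a related pair, nonempty
  because \<open>W\<close> is.\<close>

lemma path_restrict:
  "path p \<Longrightarrow> W \<le> last p \<Longrightarrow> W \<noteq> bot \<Longrightarrow> path (restrict p W)"
proof (induction p rule: induct_list012)
  case (3 x y ys)
  let ?r = "restrict (y # ys) W"
  have r: "path ?r" using 3 by (auto simp: path_Cons)
  have "hd ?r \<le> y"
    using restrict_nth_le[of W "y # ys" 0] 3(4) by (simp add: hd_conv_nth)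
  also have "y \<le> future x"
    using 3(3) by (auto simp: path_Cons related_future)
  finally have "inf x (past (hd ?r)) \<unlhd> hd ?r"
    by (rule related_inf_past)
  moreover have "hd ?r \<noteq> bot"
    using r by (metis is_path_iff list.set_sel(1))
  ultimately show ?case
    using r related_bot_iff by (auto simp: path_Cons Let_def)
qed (auto simp: path_Cons is_path_iff)

lemma path_restrict_self: "path p \<Longrightarrow> restrict p (last p) = p"
proof (induction p rule: induct_list012)
  case (3 x y ys)
  then have "restrict (y # ys) (last (y # ys)) = y # ys" by (auto simp: path_Cons)
  moreover have "x \<le> past y" using 3 by (auto simp: path_Cons related_past)
  ultimately show ?case by (simp add: Let_def inf.absorb1)
qed auto

lemma refines_restrict: "W \<le> last p \<Longrightarrow> refines q (restrict p W) \<Longrightarrow> refines q p"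
  unfolding refines_def by (metis length_past_restrict order_trans restrict_nth_le)

lemma restrict_step: "Suc n < length p \<Longrightarrow> restrict p W ! n \<le> past (restrict p W ! Suc n)"
  by (simp add: past_restrict_nth)

lemma restrict_past:
  assumes "i \<le> j" "j < length p"
  shows "restrict p W ! i \<le> past (restrict p W ! j)"
  using assms
proof (induction j rule: dec_induct)
  case base
  then show ?case by (simp add: past_increasing)
next
  case (step n)
  then show ?case using past_trans restrict_step by (meson Suc_lessD)
qed

lemma path_future_restrict:
  "path p \<Longrightarrow> V \<le> hd p \<Longrightarrow> V \<noteq> bot \<Longrightarrow> path (future_restrict (\<unlhd>) p V)"
proof (induction p arbitrary: V rule: induct_list012)
  case (3 x y ys)
  have "V \<le> past y"
    using 3 by (auto simp: path_Cons dest!: related_past intro: order_trans)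
  then have "V \<unlhd> inf y (future V)" by (rule related_inf_future)
  moreover have "hd (future_restrict (\<unlhd>) (y # ys) (inf y (future V))) = inf y (future V)"
    by (cases ys) auto
  ultimately show ?case using 3 related_bot_iff by (auto simp: path_Cons)
qed (auto simp: path_Cons is_path_iff)

lemma hd_future_restrict: "p \<noteq> [] \<Longrightarrow> hd (future_restrict le p V) = V"
  by (cases "(le, p, V)" rule: future_restrict.cases) auto

lemma future_restrict_nth_le:
  "V \<le> hd p \<Longrightarrow> n < length p \<Longrightarrow> future_restrict le p V ! n \<le> p ! n"
  by (cases n) (auto simp: future_restrict_nth_Suc future_restrict_nth_0 hd_conv_nth)

lemma future_restrict_self: "path p \<Longrightarrow> future_restrict (\<unlhd>) p (hd p) = p"
proof (induction p rule: induct_list012)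
  case (3 x y ys)
  then have "y \<le> future x" by (auto simp: path_Cons related_future)
  then show ?case using 3 by (auto simp: path_Cons inf.absorb1)
qed auto

text \<open>Each step sends \<open>V\<close> to \<open>inf y (future V)\<close>, which preserves
  joins by frame distributivity and \<open>future_Sup\<close>; hence so does the passage to the
  endpoint.\<close>

lemma SUP_last_future_restrict:
  "p \<noteq> [] \<Longrightarrow>
    (SUP V\<in>S. last (future_restrict (\<unlhd>) p V)) = last (future_restrict (\<unlhd>) p (Sup S))"
proof (induction p arbitrary: S rule: induct_list012)
  case (3 x y ys)
  have ne: "future_restrict (\<unlhd>) (y # ys) V \<noteq> []" for V
    by (metis length_future_restrict list.distinct(1) length_0_conv)
  have "inf y (future (Sup S)) = Sup ((\<lambda>V. inf y (future V)) ` S)"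
    by (simp add: future_Sup inf_Sup_distrib image_image)
  then show ?case
    using 3(2)[of "(\<lambda>V. inf y (future V)) ` S"] ne by (simp add: image_image)
qed (auto simp: image_image)

section \<open>Weak covering and its transitivity\<close>

text \<open>
  Refinement is required only of \<open>p\<close> itself, not of its restriction to \<open>last q\<close>.
\<close>

definition weakly_covers :: "'a \<Rightarrow> 'a \<Rightarrow> bool" where
  "weakly_covers A U \<longleftrightarrow> (\<forall>p. path p \<and> last p \<le> U \<longrightarrow>
     (\<exists>Q. (\<forall>q\<in>Q. path q \<and> refines q p \<and> inhabits q A) \<and> (SUP q\<in>Q. last q) = last p))"

lemma weakly_coversD:
  assumes "weakly_covers A U" "path p" "last p \<le> U"
  shows "\<exists>Q. (\<forall>q\<in>Q. path q \<and> refines q p \<and> inhabits q A) \<and> (SUP q\<in>Q. last q) = last p"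
  using assms by (simp add: weakly_covers_def)

lemma weakly_covers_last_le:
  assumes cov: "weakly_covers A U" "path p" "last p \<le> U"
    and le: "\<And>q. path q \<Longrightarrow> refines q p \<Longrightarrow> inhabits q A \<Longrightarrow> last q \<le> last p \<Longrightarrow> last q \<le> Z"
  shows "last p \<le> Z"
proof -
  obtain Q where Q: "\<forall>q\<in>Q. path q \<and> refines q p \<and> inhabits q A" "(SUP q\<in>Q. last q) = last p"
    using weakly_coversD[OF cov] by blast
  have "last q \<le> Z" if q: "q \<in> Q" for q
    using bspec[OF Q(1) q] le SUP_upper[OF q, of last] Q(2) by simp
  then have "(SUP q\<in>Q. last q) \<le> Z" by (rule SUP_least)
  then show ?thesis using Q(2) by simp
qed

lemma Cov_past_weakly_covers:
  assumes "A \<in> Cov_past (\<unlhd>) U"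
  shows "weakly_covers A U"
  unfolding weakly_covers_def
proof (intro allI impI)
  fix p assume p: "path p \<and> last p \<le> U"
  then obtain Q where Q: "local_past_refinement (\<unlhd>) p Q" "\<forall>q\<in>Q. inhabits q A"
    using assms by (auto simp: Cov_past_def lands_in_def)
  have "refines q p" if "q \<in> Q" for q
  proof (rule refines_restrict)
    show "last q \<le> last p" using Q(1) that by (metis SUP_upper local_past_refinement_def)
  qed (use Q(1) that in \<open>auto simp: local_past_refinement_def\<close>)
  then show "\<exists>Q. (\<forall>q\<in>Q. path q \<and> refines q p \<and> inhabits q A) \<and> (SUP q\<in>Q. last q) = last p"
    using Q by (auto simp: local_past_refinement_def)
qed

text \<open>\<open>r\<close> replaces \<open>q\<close> up to position \<open>m\<close>, and the rest
  of \<open>q\<close> is cut down to the future of \<open>last r\<close>. Taking \<open>tl f\<close>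
  avoids repeating \<open>last r\<close>.\<close>

lemma path_glue:
  assumes q: "path q" "m < length q"
    and r: "path r" "refines r (take (Suc m) q)" "last r \<le> q ! m"
  defines "f \<equiv> future_restrict (\<unlhd>) (drop m q) (last r)"
  shows "path (r @ tl f)" "refines (r @ tl f) q" "last (r @ tl f) = last f"
proof -
  have hd: "hd (drop m q) = q ! m" using q(2) by (simp add: hd_drop_conv_nth)
  have "last r \<noteq> bot" "r \<noteq> []" using r(1) by (auto simp: path_last_not_bot path_not_Nil)
  then have f: "path f" "f \<noteq> []" "hd f = last r"
    using path_future_restrict[of "drop m q" "last r"] path_drop[OF q] r(3) hd q(2)
    by (auto simp: f_def hd_future_restrict is_path_iff)
  have eq: "f = last r # tl f" using f by (metis list.collapse)
  have tl: "tl f = [] \<or> path (tl f) \<and> last r \<unlhd> hd (tl f)"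
    using f(1) eq path_Cons by metis
  then show "path (r @ tl f)"
    using r(1) \<open>r \<noteq> []\<close> path_append by (cases "tl f = []") auto
  show "last (r @ tl f) = last f"
    using eq by (metis last_ConsL last_ConsR last_appendR append_Nil2)
  show "refines (r @ tl f) q"
    unfolding refines_def
  proof (intro allI impI)
    fix n assume n: "n < length q"
    have "\<exists>y\<in>set (r @ tl f). y \<le> q ! n"
    proof (cases "n \<le> m")
      case True
      then have "q ! n \<in> set (take (Suc m) q)"
        using n by (auto simp: in_set_conv_nth intro!: exI[of _ n])
      then show ?thesis using r(2) by (auto simp: refines_iff)
    next
      case False
      define k where "k = n - m"
      have k: "k < length f" "0 < k" "n = m + k" using False n by (auto simp: k_def f_def)
      then have "f ! k \<in> set (tl f)"
        by (metis Suc_less_eq Suc_pred eq length_Cons nth_Cons_Suc nth_mem)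
      moreover have "f ! k \<le> q ! n"
        using future_restrict_nth_le[of "last r" "drop m q" k] r(3) hd k n q(2)
        by (simp add: f_def)
      ultimately show ?thesis by auto
    qed
    then show "\<exists>k < length (r @ tl f). (r @ tl f) ! k \<le> q ! n"
      by (metis in_set_conv_nth)
  qed
qed

text \<open>Each \<open>q\<close> is cut at a step inside \<open>A\<close>, its initial segment is
  refined by paths through \<open>B\<close>, and these are continued along \<open>q\<close>. The
  passage to the endpoint preserves joins, so the new endpoints join to
  \<open>last q\<close>.\<close>

lemma weakly_covers_trans:
  assumes B: "weakly_covers B A" and A: "weakly_covers A U"
  shows "weakly_covers B U"
  unfolding weakly_covers_def
proof (intro allI impI)
  fix p assume p: "path p \<and> last p \<le> U"
  obtain Q where Q: "\<forall>q\<in>Q. path q \<and> refines q p \<and> inhabits q A" "(SUP q\<in>Q. last q) = last p"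
    using weakly_coversD[OF A, of p] p by blast
  have "\<exists>T. (\<forall>t\<in>T. path t \<and> refines t q \<and> inhabits t B) \<and> (SUP t\<in>T. last t) = last q"
    if "q \<in> Q" for q
  proof -
    have q: "path q" "inhabits q A" using bspec[OF Q(1) that] by auto
    obtain m where m: "m < length q" "q ! m \<le> A"
      using q(2) by (auto simp: inhabits_def)
    note q = q(1)
    have take: "path (take (Suc m) q)" "last (take (Suc m) q) = q ! m"
      using path_take[OF q, of "Suc m"] m(1) by (simp, simp add: take_Suc_conv_app_nth)
    obtain R where R: "\<forall>r\<in>R. path r \<and> refines r (take (Suc m) q) \<and> inhabits r B"
      "(SUP r\<in>R. last r) = q ! m"
      using weakly_coversD[OF B take(1)] take(2) m(2) by auto
    define t where "t = (\<lambda>r. r @ tl (future_restrict (\<unlhd>) (drop m q) (last r)))"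
    have "last r \<le> q ! m" if "r \<in> R" for r using R(2) that by (metis SUP_upper)
    note glue = path_glue[OF q m(1) _ _ this]
    have "(SUP r\<in>R. last (t r)) = (SUP r\<in>R. last (future_restrict (\<unlhd>) (drop m q) (last r)))"
      using R(1) glue(3) by (intro SUP_cong) (auto simp: t_def)
    also have "\<dots> = last (future_restrict (\<unlhd>) (drop m q) (q ! m))"
      using SUP_last_future_restrict[of "drop m q" "last ` R"] R(2) m(1)
      by (simp add: image_image)
    also have "\<dots> = last q"
      using future_restrict_self[OF path_drop[OF q m(1)]] m(1) by (simp add: hd_drop_conv_nth)
    finally have "(SUP r\<in>R. last (t r)) = last q" .
    moreover have "path (t r)" "refines (t r) q" "inhabits (t r) B" if "r \<in> R" for r
      using bspec[OF R(1) that] glue(1,2)[of r] that by (auto simp: t_def inhabits_iff)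
    ultimately show ?thesis by (intro exI[of _ "t ` R"]) (auto simp: image_image)
  qed
  then obtain T where T: "\<And>q t. q \<in> Q \<Longrightarrow> t \<in> T q \<Longrightarrow> path t \<and> refines t q \<and> inhabits t B"
    "\<And>q. q \<in> Q \<Longrightarrow> (SUP t\<in>T q. last t) = last q"
    by metis
  have "(SUP t\<in>(\<Union>q\<in>Q. T q). last t) = last p"
    using Q(2) T(2) by (simp add: SUP_UNION cong: SUP_cong)
  moreover have "path t" "refines t p" "inhabits t B" if "t \<in> (\<Union>q\<in>Q. T q)" for t
    using that T(1) Q(1) refines_trans by blast+
  ultimately show "\<exists>Q. (\<forall>q\<in>Q. path q \<and> refines q p \<and> inhabits q B) \<and> (SUP q\<in>Q. last q) = last p"
    by (intro exI[of _ "\<Union>q\<in>Q. T q"]) blast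
qed

section \<open>Covering properties that follow directly from the definition\<close>

lemma Cov_past_between:
  assumes "U \<le> A" "A \<le> past U"
  shows "A \<in> Cov_past (\<unlhd>) U"
  unfolding Cov_past_def
proof (intro CollectI conjI allI impI)
  fix p assume p: "path p \<and> lands_in p U"
  then have "last p \<in> set p" "last p \<le> A"
    using assms(1) by (auto simp: lands_in_def is_path_iff)
  then have "inhabits p A" by (auto simp: inhabits_iff)
  \<comment> \<open>The path alone suffices, since restricting it to its own endpoint returns
    it.\<close>
  moreover have "local_past_refinement (\<unlhd>) p {p}"
    using p path_restrict_self by (auto simp: local_past_refinement_def refines_iff)
  ultimately show "\<exists>Q. local_past_refinement (\<unlhd>) p Q \<and> (\<forall>q\<in>Q. inhabits q A)"
    by blast
qed (fact assms(2))

text \<open>The given refinement is kept: its step in \<open>A\<close> precedes an endpoint below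
  \<open>last p\<close>, hence below \<open>W\<close>, and so lies in \<open>past W\<close>.\<close>

lemma Cov_past_restrict:
  assumes A: "A \<in> Cov_past (\<unlhd>) U" and W: "W \<le> U"
  shows "inf A (past W) \<in> Cov_past (\<unlhd>) W"
  unfolding Cov_past_def
proof (intro CollectI conjI allI impI)
  fix p assume p: "path p \<and> lands_in p W"
  then have "lands_in p U" using W by (auto simp: lands_in_def)
  then obtain Q where Q: "local_past_refinement (\<unlhd>) p Q" "\<forall>q\<in>Q. inhabits q A"
    using A p by (auto simp: Cov_past_def)
  have "inhabits q (inf A (past W))" if q: "q \<in> Q" for q
  proof -
    obtain m where m: "m < length q" "q ! m \<le> A"
      using Q(2) q by (auto simp: inhabits_def)
    have "path q" using Q(1) q by (simp add: local_past_refinement_def)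
    have "last q \<le> last p"
      using Q(1) q by (metis SUP_upper local_past_refinement_def)
    have "q ! m \<unlhd> last q"
      using \<open>path q\<close> path_nth_related[of q m "length q - 1"] m(1)
      by (simp add: last_conv_nth path_not_Nil)
    then have "q ! m \<le> past W"
      using \<open>last q \<le> last p\<close> p past_mono related_past unfolding lands_in_def
      by (meson order_trans)
    then show ?thesis using m by (auto simp: inhabits_def)
  qed
  then show "\<exists>Q. local_past_refinement (\<unlhd>) p Q \<and> (\<forall>q\<in>Q. inhabits q (inf A (past W)))"
    using Q(1) by blast
qed simp

lemma Cov_past_related:
  assumes "A \<in> Cov_past (\<unlhd>) U"
  shows "A \<unlhd> U"
proof (rule relatedI)
  show "A \<le> past U" using assms by (simp add: Cov_past_def)
  show "U \<le> future A"
  proof (cases "U = bot")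
    case False
    \<comment> \<open>The one-step path tests the covering: a refinement passing through
      \<open>A\<close> ends in \<open>future A\<close>.\<close>
    then have "path [U]" by (simp add: path_Cons)
    have "last [U] \<le> future A"
    proof (rule weakly_covers_last_le[OF Cov_past_weakly_covers[OF assms] \<open>path [U]\<close>])
      fix q assume q: "path q" "inhabits q A"
      then obtain m where m: "m < length q" "q ! m \<le> A"
        by (auto simp: inhabits_def)
      then have "q ! m \<unlhd> last q"
        using q(1) path_nth_related[of q m "length q - 1"]
        by (simp add: last_conv_nth path_not_Nil)
      then show "last q \<le> future A"
        using m(2) future_mono related_future by (meson order_trans)
    qed simp
    then show ?thesis by simp
  qed simp
qed

text \<open>No path lands in \<open>bot\<close>, so only the bound by \<open>past bot\<close>
  remains.\<close>

lemma Cov_past_bot: "Cov_past (\<unlhd>) bot = {bot}"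
proof -
  have "\<not> lands_in p bot" if "path p" for p
    using path_last_not_bot[OF that] by (simp add: lands_in_def bot_unique)
  then show ?thesis by (auto simp: Cov_past_def bot_unique)
qed

subsection \<open>Words of labels\<close>

text \<open>
  A label is an index of a step of \<open>p\<close>, and the last index is implicitly appended to every word.
  \<open>reach p \<sigma>\<close> is the part of the step labelled \<open>hd \<sigma>\<close> from which one can pass through steps
  labelled \<open>\<sigma>\<close> in this order and end in \<open>last p\<close>, where between \<open>i\<close> and a larger next label
  \<open>j\<close> the labels strictly between them are visited too. Hence the labels after \<open>hd \<sigma>\<close> also
  occur in increasing order, as membership in a restriction of \<open>p\<close> demands.
\<close>

abbreviation climb :: "'a list \<Rightarrow> nat list \<Rightarrow> 'a \<Rightarrow> 'a" where
  "climb p is Z \<equiv> foldr (\<lambda>i Y. inf (p ! i) (past Y)) is Z"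

abbreviation next_label :: "'a list \<Rightarrow> nat list \<Rightarrow> nat" where
  "next_label p \<sigma> \<equiv> hd (\<sigma> @ [length p - 1])"

fun reach :: "'a list \<Rightarrow> nat list \<Rightarrow> 'a" where
  "reach p [] = last p"
| "reach p (i # \<sigma>) = inf (p ! i) (past (climb p [Suc i..<next_label p \<sigma>] (reach p \<sigma>)))"

lemma climb_mono: "Y \<le> Z \<Longrightarrow> climb p is Y \<le> climb p is Z"
  by (induction "is") (auto intro: le_infI2 past_mono)

lemma past_climb: "past (climb p is Z) \<le> past Z"
proof (induction "is")
  case (Cons i "is")
  have "past (inf (p ! i) (past (climb p is Z))) \<le> past (past (climb p is Z))"
    by (simp add: past_mono)
  then show ?case using Cons past_past by (auto intro: order_trans)
qed simp

text \<open>Narrows a target to the future of \<open>X\<close> without losing the way to it: each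
  visited part is first cut to some \<open>X'\<close> in that future, and then
  \<open>future X' \<le> future X\<close> by transitivity.\<close>

lemma climb_future:
  "X \<le> past (climb p is Z) \<Longrightarrow> X \<le> past (climb p is (inf Z (future X)))"
proof (induction "is" arbitrary: X)
  case Nil
  then show ?case using related_inf_future related_past by simp
next
  case (Cons i "is")
  define X' where "X' = inf (climb p (i # is) Z) (future X)"
  have X: "X \<le> past X'"
    using Cons.prems related_inf_future related_past by (simp add: X'_def)
  have "X' \<le> past (climb p is (inf Z (future X')))"
    by (rule Cons.IH) (simp add: X'_def le_infI1)
  also have "future X' \<le> future X"
    using future_mono[of X' "future X"] future_future[of X] by (simp add: X'_def)
  then have "past (climb p is (inf Z (future X'))) \<le> past (climb p is (inf Z (future X)))"
    by (intro past_mono climb_mono inf_mono) auto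
  finally have "X' \<le> climb p (i # is) (inf Z (future X))"
    by (simp add: X'_def le_infI1)
  then show ?case using X past_mono order_trans by blast
qed

text \<open>\<open>climb\<close> and \<open>restrict\<close> obey the same recursion between
  \<open>i\<close> and \<open>j\<close>, so the comparison at \<open>j\<close> propagates
  downwards.\<close>

lemma climb_le_restrict:
  assumes "i \<le> j" "j < length p" "Z \<le> restrict p Y ! j"
  shows "climb p [i..<j] Z \<le> restrict p Y ! i"
  using assms(1)
proof (induction i rule: inc_induct)
  case base
  then show ?case using assms(3) by simp
next
  case (step n)
  then have "climb p [n..<j] Z = inf (p ! n) (past (climb p [Suc n..<j] Z))"
    by (simp add: upt_conv_Cons)
  also have "\<dots> \<le> restrict p Y ! n"
    using step assms(2) past_mono by (auto simp: past_restrict_nth le_infI2)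
  finally show ?case .
qed

text \<open>The steps of \<open>x\<close> at positions strictly between \<open>i\<close> and
  \<open>j\<close> serve as visits to these labels; \<open>j \<le> Suc m\<close> makes all of them
  come no later than \<open>x ! m\<close>.\<close>

lemma path_past_climb:
  assumes x: "path x" "m < length x" "x ! m \<le> Z" and j: "j \<le> Suc m"
    and le: "\<And>k. k < j \<Longrightarrow> x ! k \<le> p ! k" and "i \<le> m"
  shows "x ! i \<le> past (climb p [Suc i..<j] Z)"
  using \<open>i \<le> m\<close>
proof (induction "m - i" arbitrary: i rule: less_induct)
  case less
  show ?case
  proof (cases "Suc i < j")
    case False
    have "x ! i \<le> past (x ! m)" using path_nth_related x less.prems related_past by blast
    then show ?thesis using False order_trans[OF _ past_mono[OF x(3)]] by simp
  next
    case True
    then have "x ! Suc i \<le> past (climb p [Suc (Suc i)..<j] Z)"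
      using less.hyps[of "Suc i"] j by simp
    then have "x ! Suc i \<le> climb p [Suc i..<j] Z"
      using True le by (simp add: upt_conv_Cons)
    moreover have "x ! i \<le> past (x ! Suc i)"
      using path_nth_related[of x i "Suc i"] x True j related_past by simp
    ultimately show ?thesis using past_mono order_trans by blast
  qed
qed

text \<open>\<open>p\<close> itself is the continuation: from \<open>i\<close> on it runs through
  all later labels to its end.\<close>

lemma reach_single:
  assumes "path p" "i < length p - 1"
  shows "p ! i \<le> reach p [i]"
  using path_past_climb[of p "length p - 1" "last p" "length p - 1" p i] assms
  by (auto simp: last_conv_nth path_not_Nil)

text \<open>
  The path is built from \<open>T\<close> by joining each visit of \<open>s\<close> with all of \<open>reach p \<sigma>\<close> in the future of
  what was built before. The endpoint thereby contains the ends of all continuations, so no step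
  loses its justification when \<open>p\<close> is restricted to that endpoint.
\<close>

lemma path_along_word:
  assumes "path p" and s: "path s" "\<And>l. l < length p \<Longrightarrow> k l < length s"
    and "sorted (map k (\<sigma> @ [length p - 1]))" "set \<sigma> \<subseteq> {..<length p - 1}"
    and "\<And>\<tau> \<rho>. \<sigma> = \<tau> @ \<rho> \<Longrightarrow> s ! k (next_label p \<rho>) \<le> reach p \<rho>"
    and "T \<noteq> bot" "T \<le> reach p \<sigma>" "s ! k (next_label p \<sigma>) \<le> T"
  shows "\<exists>q. path q \<and> hd q = T \<and> last q \<le> last p \<and> s ! k (length p - 1) \<le> last q \<and>
    T \<le> restrict p (last q) ! next_label p \<sigma> \<and>
    (\<forall>l\<in>set \<sigma>. \<exists>y\<in>set q. y \<le> restrict p (last q) ! l)"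
  using assms(4-)
proof (induction \<sigma> arbitrary: T)
  case Nil
  then show ?case
    using past_restrict_nth_last[of p "(\<unlhd>)" T] path_not_Nil[OF \<open>path p\<close>]
    by (intro exI[of _ "[T]"]) (auto simp: path_Cons)
next
  case (Cons i \<sigma>)
  define j where "j = next_label p \<sigma>"
  define T' where "T' = sup (s ! k j) (inf (reach p \<sigma>) (future T))"
  have i: "Suc i < length p" using Cons.prems(2) by auto
  have j: "j < length p"
    using Cons.prems(2) i by (cases \<sigma>) (auto simp: j_def)
  have kij: "k i \<le> k j"
    using Cons.prems(1) by (cases \<sigma>) (auto simp: j_def)
  have T: "T \<le> p ! i" "T \<le> past (climb p [Suc i..<j] (reach p \<sigma>))"
    using Cons.prems(5) by (simp_all add: j_def)
  have "T \<le> past (climb p [Suc i..<j] (inf (reach p \<sigma>) (future T)))"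
    by (rule climb_future) (fact T(2))
  also have "\<dots> \<le> past (climb p [Suc i..<j] T')"
    by (intro past_mono climb_mono) (simp add: T'_def)
  finally have TT': "T \<le> past (climb p [Suc i..<j] T')" .
  \<comment> \<open>The word lists labels by time of visit, so the visit to \<open>j\<close> lies in
    the future of the visit to \<open>i\<close>, which is below \<open>T\<close>.\<close>
  have "s ! k i \<unlhd> s ! k j"
    using path_nth_related[OF s(1) kij] s(2) j by simp
  then have "s ! k j \<le> future T"
    using Cons.prems(6) by (auto intro: order_trans[OF related_future future_mono])
  then have "T' \<le> future T" by (simp add: T'_def)
  moreover have "T \<le> past T'" using TT' past_climb order_trans by blast
  ultimately have rel: "T \<unlhd> T'" by (simp add: relatedI)
  have "T' \<le> reach p \<sigma>"
    using Cons.prems(3)[of "[i]" \<sigma>] by (simp add: T'_def j_def)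
  moreover have "T' \<noteq> bot" using rel related_bot_iff Cons.prems(4) by blast
  moreover have "sorted (map k (\<sigma> @ [length p - 1]))" using Cons.prems(1) by simp
  moreover have "s ! k (next_label p \<rho>) \<le> reach p \<rho>" if "\<sigma> = \<tau> @ \<rho>" for \<tau> \<rho>
    using Cons.prems(3)[of "i # \<tau>" \<rho>] that by simp
  moreover have "s ! k (next_label p \<sigma>) \<le> T'" by (simp add: T'_def j_def)
  ultimately obtain q where q: "path q" "hd q = T'" "last q \<le> last p" "s ! k (length p - 1) \<le> last q"
    "T' \<le> restrict p (last q) ! j" "\<forall>l\<in>set \<sigma>. \<exists>y\<in>set q. y \<le> restrict p (last q) ! l"
    using Cons.IH[of T'] Cons.prems(2) unfolding j_def by auto
  \<comment> \<open>If the next label is larger than \<open>i\<close>, the climb supplies the labels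
    in between; otherwise the restriction at \<open>j\<close> already lies in the past of the
    restriction at \<open>Suc i\<close>.\<close>
  have "T \<le> past (restrict p (last q) ! Suc i)"
  proof (cases "Suc i \<le> j")
    case True
    then show ?thesis
      using climb_le_restrict[OF _ j q(5)] TT' past_mono order_trans by blast
  next
    case False
    then have "T \<le> past (restrict p (last q) ! j)"
      using order_trans[OF TT' past_mono] q(5) by simp
    moreover have "restrict p (last q) ! j \<le> past (restrict p (last q) ! Suc i)"
      using restrict_past False i by simp
    ultimately show ?thesis using past_trans by blast
  qed
  then have "T \<le> restrict p (last q) ! i" using T(1) i by (simp add: past_restrict_nth)
  then show ?case
    using q rel Cons.prems(4) path_not_Nil[OF q(1)]
    by (intro exI[of _ "T # q"]) (auto simp: path_Cons)
qed

lemma path_append_past: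
  assumes "path (xs @ ys)" "xs \<noteq> []" "y \<in> set ys"
  shows "last xs \<le> past y"
proof -
  obtain k where k: "k < length ys" "y = ys ! k" using assms(3) by (auto simp: in_set_conv_nth)
  then show ?thesis
    using path_nth_related[OF assms(1), of "length xs - 1" "length xs + k"] assms(2) related_past
    by (simp add: nth_append last_conv_nth)
qed

text \<open>
  Makes the order of the visits before \<open>B\<close> irrelevant: in front of the visit of the largest label
  among them, the smaller ones can be visited in increasing order.
\<close>

lemma prepend_prefix:
  assumes p: "path p" "n < length p - 1"
    and q: "path (e # q)" "q \<noteq> []" "e \<le> p ! n"
    and hits: "\<And>l. n < l \<Longrightarrow> l < length p \<Longrightarrow> \<exists>y\<in>set q. y \<le> restrict p (last q) ! l"
  shows "\<exists>r. path (r @ q) \<and> refines (r @ q) (restrict p (last q))"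
proof -
  define r where "r = restrict (take (Suc n) p) e"
  have n: "Suc n < length p" using p(2) by simp
  have last_take: "last (take (Suc n) p) = p ! n" using n by (simp add: take_Suc_conv_app_nth)
  have r: "path r" "last r = e" "length r = Suc n" "r \<noteq> []"
    using path_restrict[of "take (Suc n) p" e] path_take[OF p(1), of "Suc n"] q(1,3) last_take n
      last_restrict[of "take (Suc n) p" e] path_not_Nil[OF p(1)]
    by (auto simp: r_def path_Cons path_not_Nil)
  have path: "path (r @ q)"
    using path_append[of r q] r q by (auto simp: path_Cons)
  have "r ! l \<le> restrict p (last q) ! l" if "l \<le> n" for l
    using that
  proof (induction l rule: inc_induct)
    case base
    \<comment> \<open>Label \<open>Suc n\<close> is visited after \<open>e\<close>, which places
      \<open>e\<close> in the past of the restricted step there.\<close>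
    obtain y where y: "y \<in> set q" "y \<le> restrict p (last q) ! Suc n" using hits n by blast
    have "e \<le> past y" using path_append_past[OF path r(4) y(1)] r(2) by simp
    then have "e \<le> past (restrict p (last q) ! Suc n)" using y(2) past_mono order_trans by blast
    moreover have "r ! n = e" using r by (metis diff_Suc_1 last_conv_nth)
    ultimately show ?case using n q(3) by (simp add: past_restrict_nth)
  next
    case (step l)
    then have "r ! l = inf (p ! l) (past (r ! Suc l))"
      using n by (simp add: r_def past_restrict_nth)
    also have "\<dots> \<le> inf (p ! l) (past (restrict p (last q) ! Suc l))"
      using step past_mono by (intro inf_mono) auto
    finally show ?case using step n by (simp add: past_restrict_nth)
  qed
  moreover have "r ! l \<in> set (r @ q)" if "l \<le> n" for l using that r(3) by simp
  ultimately have "\<exists>y\<in>set (r @ q). y \<le> restrict p (last q) ! l" if "l < length p" for l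
    using hits[of l] that by (cases "l \<le> n") auto
  then have "refines (r @ q) (restrict p (last q))"
    unfolding refines_iff by (metis in_set_conv_nth length_past_restrict)
  then show ?thesis using path by blast
qed

text \<open>These paths have the good endpoints: all of them together form a local past refinement
  as soon as their endpoints join to \<open>last p\<close>.\<close>

definition covering_path :: "'a \<Rightarrow> 'a list \<Rightarrow> 'a list \<Rightarrow> bool" where
  "covering_path B p q \<longleftrightarrow> path q \<and> inhabits q B \<and>
     refines q (restrict p (last q)) \<and> last q \<le> last p"

text \<open>The labels are split at the least \<open>m\<close> from which on all are visited after
  \<open>b\<close>. Those from \<open>m\<close> on follow the visit to \<open>B\<close> in the order
  given by \<open>s\<close>; the smaller ones are put in front of it in increasing order.\<close>

lemma covering_path_extending:
  assumes p: "path p" and s: "path s" "b < length s" "s ! b \<le> B"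
    and k: "\<And>l. l < length p \<Longrightarrow> k l < length s" "k (length p - 1) = length s - 1"
    and le: "\<And>l. l < length p - 1 \<Longrightarrow> s ! k l \<le> p ! l" "last s \<le> last p"
    and reach: "\<And>m \<tau> \<rho>. sort_key k [m..<length p - 1] = \<tau> @ \<rho> \<Longrightarrow>
      s ! k (next_label p \<rho>) \<le> reach p \<rho>"
  shows "\<exists>q. covering_path B p q \<and> last s \<le> last q"
proof -
  define N where "N = length p - 1"
  have N: "N < length p" "length p = Suc N" using path_not_Nil[OF p] by (auto simp: N_def)
  define m where "m = (LEAST m. \<forall>j. m \<le> j \<and> j < N \<longrightarrow> b < k j)"
  have "\<forall>j. m \<le> j \<and> j < N \<longrightarrow> b < k j" unfolding m_def by (rule LeastI[of _ N]) auto
  then have m: "\<And>j. m \<le> j \<Longrightarrow> j < N \<Longrightarrow> b < k j" by blast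
  have mN: "m \<le> N" unfolding m_def by (rule Least_le) auto
  define \<tau> where "\<tau> = sort_key k [m..<N]"
  have set: "set \<tau> = {m..<N}" by (simp add: \<tau>_def)
  define T where "T = s ! k (next_label p \<tau>)"
  have nl: "next_label p \<tau> \<le> N" "b \<le> k (next_label p \<tau>)"
  proof -
    have kN: "k N = length s - 1" using k(2) by (simp add: N_def)
    have "next_label p \<tau> = N \<or> next_label p \<tau> \<in> {m..<N}"
      unfolding set[symmetric] by (cases \<tau>) (auto simp: N_def)
    then show "next_label p \<tau> \<le> N" "b \<le> k (next_label p \<tau>)"
      using m[of "next_label p \<tau>"] s(2) kN by fastforce+
  qed
  have kl: "k (next_label p \<tau>) < length s" using k(1) nl(1) N by simp
  have "k l \<le> k N" if "l < length p" for l using k(1)[OF that] k(2) by (simp add: N_def)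
  then have "\<forall>l\<in>set \<tau>. k l \<le> k N" using N(2) set by simp
  moreover have "sorted (map k \<tau>)" by (simp add: \<tau>_def)
  ultimately have sorted: "sorted (map k (\<tau> @ [length p - 1]))"
    by (simp add: sorted_append N_def)
  have suffix: "s ! k (next_label p \<rho>) \<le> reach p \<rho>" if "\<tau> = \<upsilon> @ \<rho>" for \<upsilon> \<rho>
    using reach[of m \<upsilon> \<rho>] that by (simp add: \<tau>_def N_def)
  have T: "T \<noteq> bot" "T \<le> reach p \<tau>"
    using path_nth_not_bot[OF s(1) kl] suffix[of "[]" \<tau>] by (simp_all add: T_def)
  have "set \<tau> \<subseteq> {..<length p - 1}" using set by (auto simp: N_def)
  have "\<exists>q. path q \<and> hd q = T \<and> last q \<le> last p \<and> s ! k (length p - 1) \<le> last q \<and>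
    T \<le> restrict p (last q) ! next_label p \<tau> \<and>
    (\<forall>l\<in>set \<tau>. \<exists>y\<in>set q. y \<le> restrict p (last q) ! l)"
  proof (rule path_along_word[OF p s(1) k(1) sorted \<open>set \<tau> \<subseteq> _\<close> _ T])
    show "s ! k (next_label p \<rho>) \<le> reach p \<rho>" if "\<tau> = \<upsilon> @ \<rho>" for \<upsilon> \<rho>
      using suffix that .
  qed (simp_all add: T_def)
  then obtain q where q: "path q" "hd q = T" "last q \<le> last p" "s ! k N \<le> last q"
    "\<forall>l\<in>set \<tau>. \<exists>y\<in>set q. y \<le> restrict p (last q) ! l"
    unfolding N_def by blast
  \<comment> \<open>The steps of \<open>q\<close> may have been enlarged, so \<open>s ! b\<close> is
    added unchanged to keep \<open>B\<close> inhabited.\<close>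
  define q1 where "q1 = s ! b # q"
  have q1: "path q1" "last q1 = last q" "hd q1 = s ! b"
    using q(1,2) path_nth_not_bot[OF s(1,2)] path_nth_related[OF s(1) nl(2) kl] path_not_Nil[OF q(1)]
    by (auto simp: q1_def path_Cons T_def)
  have last: "last s \<le> last q" "inhabits q1 B"
    using q(4) k(2) path_not_Nil[OF s(1)] s(3)
    by (auto simp: last_conv_nth N_def inhabits_iff q1_def)
  have "last q \<in> set q1" using path_not_Nil[OF q(1)] by (simp add: q1_def)
  then have "\<exists>y\<in>set q1. y \<le> restrict p (last q1) ! N"
    using past_restrict_nth_last[of p "(\<unlhd>)" "last q1"] path_not_Nil[OF p] q1(2)
    by (auto simp: N_def)
  then have hits: "\<exists>y\<in>set q1. y \<le> restrict p (last q1) ! l" if "m \<le> l" "l < length p" for l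
    using q(5) set that N(2) q1(2) by (cases "l = N") (auto simp: q1_def)
  show ?thesis
  proof (cases m)
    case 0
    then have "refines q1 (restrict p (last q1))"
      using hits unfolding refines_iff by (metis in_set_conv_nth length_past_restrict le0)
    then show ?thesis using q1 q(3) last by (auto simp: covering_path_def)
  next
    case (Suc n)
    \<comment> \<open>By minimality of \<open>m\<close>, label \<open>n\<close> is visited no later
      than \<open>b\<close>, so a prefix ending in \<open>s ! k n\<close> can precede
      \<open>s ! b\<close>.\<close>
    have "\<not> (\<forall>j. n \<le> j \<and> j < N \<longrightarrow> b < k j)"
      using not_less_Least[of n "\<lambda>m. \<forall>j. m \<le> j \<and> j < N \<longrightarrow> b < k j"] Suc by (simp add: m_def)
    then have n: "k n \<le> b" "n < N"
      using m Suc by (metis not_less le_antisym not_less_eq_eq)+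
    have "path (s ! k n # q1)"
      using q1 path_nth_related[OF s(1) n(1) s(2)] path_nth_not_bot[OF s(1)] k(1) n N
      by (auto simp: path_Cons)
    then obtain r where r: "path (r @ q1)" "refines (r @ q1) (restrict p (last q1))"
      using prepend_prefix[OF p, of n "s ! k n" q1] n le(1) hits Suc
      by (auto simp: N_def q1_def)
    moreover have "last (r @ q1) = last q" using q1 by (simp add: q1_def)
    ultimately have "covering_path B p (r @ q1)"
      using last q(3) q1(2) by (auto simp: covering_path_def inhabits_iff)
    then show ?thesis using last \<open>last (r @ q1) = last q\<close> by metis
  qed
qed

subsection \<open>Maximal choices\<close>

text \<open>
  Below stage \<open>h\<close> the bounds \<open>Z\<close> apply to the initial segment of \<open>x\<close>; the labels from \<open>h\<close> on may be
  visited anywhere in \<open>x\<close>. In \<open>stable\<close>, the label \<open>h\<close> is a record of \<open>s\<close>: all larger labels are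
  visited later. Then the labels up to \<open>h\<close> can be put in increasing order in front of \<open>s ! k0\<close>.
\<close>

definition staged :: "'a list \<Rightarrow> 'a \<Rightarrow> nat \<Rightarrow> (nat \<Rightarrow> 'a) \<Rightarrow> 'a list \<Rightarrow> bool" where
  "staged p V h Z x \<longleftrightarrow> path x \<and> last x \<le> last p \<and> \<not> last x \<le> V \<and> h \<le> length x \<and>
     (\<forall>i<h. x ! i \<le> Z i) \<and> (\<forall>j. h \<le> j \<and> j < length p - 1 \<longrightarrow> inhabits x (Z j))"

definition stable :: "'a list \<Rightarrow> 'a \<Rightarrow> (nat \<Rightarrow> 'a) \<Rightarrow> nat \<Rightarrow> bool" where
  "stable p V Z h \<longleftrightarrow> (\<forall>s k0 k i j \<sigma>.
     path s \<and> last s \<le> last p \<and> \<not> last s \<le> V \<and> k0 \<le> k \<and> k < length s \<and> s ! k0 \<le> Z h \<and>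
     (\<forall>l. h < l \<and> l < length p - 1 \<longrightarrow> (\<exists>k'\<ge>k0. k' < length s \<and> s ! k' \<le> Z l)) \<and>
     i \<le> h \<and> j \<le> h \<and> distinct (i # j # \<sigma>) \<and> set (i # j # \<sigma>) \<subseteq> {..<length p - 1} \<and>
     s ! k \<le> reach p (j # \<sigma>) \<longrightarrow> Z i \<le> reach p (i # j # \<sigma>))"

text \<open>In \<open>stable\<close>, the hypotheses use \<open>Z\<close> only from \<open>h\<close>
  on, where it is unchanged, and the conclusion only up to \<open>h\<close>, where lowering it
  weakens the claim. So later choices preserve earlier stability.\<close>

lemma stable_antimono:
  assumes "stable p V Z h" "\<And>i. i \<le> h \<Longrightarrow> Z' i \<le> Z i" "\<And>l. h \<le> l \<Longrightarrow> Z' l = Z l"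
  shows "stable p V Z' h"
  unfolding stable_def
proof (intro allI impI, elim conjE)
  fix s k0 k i j \<sigma>
  assume *: "path s" "last s \<le> last p" "\<not> last s \<le> V" "k0 \<le> k" "k < length s" "s ! k0 \<le> Z' h"
    "\<forall>l. h < l \<and> l < length p - 1 \<longrightarrow> (\<exists>k'\<ge>k0. k' < length s \<and> s ! k' \<le> Z' l)"
    "i \<le> h" "j \<le> h" "distinct (i # j # \<sigma>)" "set (i # j # \<sigma>) \<subseteq> {..<length p - 1}"
    "s ! k \<le> reach p (j # \<sigma>)"
  then have "Z i \<le> reach p (i # j # \<sigma>)"
    using assms(3) by (intro assms(1)[unfolded stable_def, rule_format, of s k0 k]) auto
  then show "Z' i \<le> reach p (i # j # \<sigma>)"
    using assms(2)[OF \<open>i \<le> h\<close>] by (rule order_trans[rotated])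
qed

text \<open>\<open>y\<close> has the fewest repetition-free words that fail from its initial steps.
  Shrinking these steps can only remove failures, so by minimality it removes none.\<close>

lemma staged_minimal:
  assumes "staged p V h Z x"
  obtains y where "staged p V h Z y"
    "\<And>y' i \<sigma>. staged p V h Z y' \<Longrightarrow> (\<And>i. i < h \<Longrightarrow> y' ! i \<le> y ! i) \<Longrightarrow> distinct (i # \<sigma>) \<Longrightarrow>
      set (i # \<sigma>) \<subseteq> {..<length p - 1} \<Longrightarrow> i < h \<Longrightarrow> y' ! i \<le> reach p (i # \<sigma>) \<Longrightarrow>
      y ! i \<le> reach p (i # \<sigma>)"
proof -
  define bad where "bad y = {\<sigma>. set \<sigma> \<subseteq> {..<length p - 1} \<and> distinct \<sigma> \<and>
    \<sigma> \<noteq> [] \<and> hd \<sigma> < h \<and> \<not> y ! hd \<sigma> \<le> reach p \<sigma>}" for y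
  have fin: "finite (bad y)" for y
    by (rule finite_subset[OF _ finite_subset_distinct[of "{..<length p - 1}"]])
      (auto simp: bad_def)
  obtain y where y: "staged p V h Z y"
    "\<And>y'. staged p V h Z y' \<Longrightarrow> card (bad y) \<le> card (bad y')"
    using ex_has_least_nat[of "staged p V h Z" x "\<lambda>y. card (bad y)"] assms by blast
  show thesis
  proof (rule that[OF y(1)])
    fix y' i \<sigma>
    assume y': "staged p V h Z y'" "\<And>i. i < h \<Longrightarrow> y' ! i \<le> y ! i"
      and \<sigma>: "distinct (i # \<sigma>)" "set (i # \<sigma>) \<subseteq> {..<length p - 1}" "i < h"
        "y' ! i \<le> reach p (i # \<sigma>)"
    have "bad y' \<subseteq> bad y" using y'(2) by (auto simp: bad_def intro: order_trans)
    then have "bad y' = bad y" using card_seteq[OF fin] y(2)[OF y'(1)] by blast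
    moreover have "i # \<sigma> \<notin> bad y'" using \<sigma>(4) by (simp add: bad_def)
    ultimately show "y ! i \<le> reach p (i # \<sigma>)" using \<sigma> by (auto simp: bad_def)
  qed
qed

text \<open>The steps of a minimal \<open>y\<close> up to \<open>h\<close> become the new bounds.
  For stability, \<open>s\<close> is spliced onto the initial segment of \<open>y\<close>; the
  result reaches the word from \<open>i\<close>, and by minimality so does \<open>y\<close>.\<close>

lemma staged_descend:
  assumes p: "path p" and h: "h < length p - 1"
    and x: "staged p V (Suc h) Z x" and Z: "\<And>i. i < length p - 1 \<Longrightarrow> Z i \<le> p ! i"
  obtains Z' y where "staged p V h Z' y" "stable p V Z' h"
    "\<And>i. i \<le> h \<Longrightarrow> Z' i \<le> Z i" "\<And>i. h < i \<Longrightarrow> Z' i = Z i"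
proof -
  obtain y where y: "staged p V (Suc h) Z y" and min:
    "\<And>y' i \<sigma>. staged p V (Suc h) Z y' \<Longrightarrow> (\<And>i. i < Suc h \<Longrightarrow> y' ! i \<le> y ! i) \<Longrightarrow>
      distinct (i # \<sigma>) \<Longrightarrow> set (i # \<sigma>) \<subseteq> {..<length p - 1} \<Longrightarrow> i < Suc h \<Longrightarrow>
      y' ! i \<le> reach p (i # \<sigma>) \<Longrightarrow> y ! i \<le> reach p (i # \<sigma>)"
    using staged_minimal[OF x] by metis
  define Z' where "Z' = (\<lambda>i. if i \<le> h then y ! i else Z i)"
  have yh: "path y" "h < length y" "\<And>i. i \<le> h \<Longrightarrow> y ! i \<le> Z i"
    using y by (auto simp: staged_def)
  have "stable p V Z' h"
    unfolding stable_def
  proof (intro allI impI, elim conjE)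
    fix s k0 k i j \<sigma>
    assume s: "path s" "last s \<le> last p" "\<not> last s \<le> V" "k0 \<le> k" "k < length s" "s ! k0 \<le> Z' h"
      and hits: "\<forall>l. h < l \<and> l < length p - 1 \<longrightarrow> (\<exists>k'\<ge>k0. k' < length s \<and> s ! k' \<le> Z' l)"
      and \<sigma>: "i \<le> h" "j \<le> h" "distinct (i # j # \<sigma>)" "set (i # j # \<sigma>) \<subseteq> {..<length p - 1}"
        "s ! k \<le> reach p (j # \<sigma>)"
    define r where "r = restrict (take (Suc h) y) (s ! k0)"
    define y' where "y' = r @ drop (Suc k0) s"
    have last_take: "last (take (Suc h) y) = y ! h"
      using yh(2) by (simp add: take_Suc_conv_app_nth)
    have k0: "k0 < length s" "s ! k0 \<le> y ! h" using s by (auto simp: Z'_def)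
    have r: "path r" "last r = s ! k0" "length r = Suc h" "r \<noteq> []"
      using path_restrict[of "take (Suc h) y" "s ! k0"] path_take[OF yh(1), of "Suc h"] k0 last_take
        last_restrict[of "take (Suc h) y"] path_not_Nil[OF yh(1)] path_nth_not_bot[OF s(1)] yh(2)
      by (auto simp: r_def path_not_Nil)
    have path: "path y'"
    proof (cases "Suc k0 < length s")
      case True
      then show ?thesis
        using r path_drop[OF s(1) True] path_nth_related[OF s(1), of k0 "Suc k0"]
        by (auto simp: y'_def path_append hd_drop_conv_nth)
    qed (simp add: y'_def r)
    have last: "last y' = last s"
    proof (cases "Suc k0 < length s")
      case False
      then have "k0 = length s - 1" using k0 by simp
      then show ?thesis using False r path_not_Nil[OF s(1)] by (simp add: y'_def last_conv_nth)
    qed (simp add: y'_def)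
    \<comment> \<open>\<open>r\<close> has length \<open>Suc h\<close> and ends in
      \<open>s ! k0\<close>, so position \<open>k'\<close> of \<open>s\<close> becomes
      \<open>h + (k' - k0)\<close>.\<close>
    have nth: "y' ! (h + (k' - k0)) = s ! k'" "h + (k' - k0) < length y'"
      if k': "k0 \<le> k'" "k' < length s" for k'
    proof -
      have "r ! h = s ! k0" using r by (metis diff_Suc_1 last_conv_nth)
      then show "y' ! (h + (k' - k0)) = s ! k'"
        using r(3) k' by (cases "k' = k0") (auto simp: y'_def nth_append)
      show "h + (k' - k0) < length y'" using r(3) k' by (simp add: y'_def)
    qed
    have le: "y' ! l \<le> y ! l" if "l < Suc h" for l
      using restrict_nth_le[of "s ! k0" "take (Suc h) y" l] that r(3) k0(2) last_take yh(2)
      by (simp add: y'_def r_def nth_append)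
    have "inhabits y' (Z l)" if "Suc h \<le> l" "l < length p - 1" for l
    proof -
      have "Z' l = Z l" "h < l" using that(1) by (simp_all add: Z'_def)
      then obtain k' where "k0 \<le> k'" "k' < length s" "s ! k' \<le> Z l"
        using hits \<open>l < length p - 1\<close> by metis
      then show ?thesis using nth[of k'] by (auto simp: inhabits_def)
    qed
    moreover have "y' ! l \<le> Z l" if "l < Suc h" for l
      using order_trans[OF le yh(3)] that by simp
    moreover have "Suc h \<le> length y'" using r(3) by (simp add: y'_def)
    ultimately have staged: "staged p V (Suc h) Z y'"
      using path last s(2,3) by (simp add: staged_def)
    have "y' ! i \<le> past (climb p [Suc i..<j] (reach p (j # \<sigma>)))"
    proof (rule path_past_climb[OF path, of "h + (k - k0)"])
      show "y' ! l \<le> p ! l" if "l < j" for l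
        using order_trans[OF order_trans[OF le yh(3)] Z] h that \<sigma>(2) by simp
    qed (use nth[OF s(4,5)] \<sigma> in auto)
    moreover have "y' ! i \<le> p ! i"
      using order_trans[OF order_trans[OF le yh(3)] Z] h \<sigma>(1) by simp
    ultimately have reach: "y' ! i \<le> reach p (i # j # \<sigma>)" by simp
    have "y ! i \<le> reach p (i # j # \<sigma>)"
    proof (rule min[OF staged])
      show "y' ! l \<le> y ! l" if "l < Suc h" for l using le that .
    qed (fact \<sigma>(3) \<sigma>(4) reach | use \<sigma>(1) in simp)+
    then show "Z' i \<le> reach p (i # j # \<sigma>)" using \<sigma>(1) by (simp add: Z'_def)
  qed
  moreover have "inhabits y (y ! h)" using yh(2) by (auto simp: inhabits_def)
  then have "staged p V h Z' y"
    using y by (auto simp: staged_def Z'_def)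
  ultimately show thesis
    using that[of Z' y] yh(3) by (auto simp: Z'_def)
qed

text \<open>Descends from the last label, starting with \<open>p\<close> and its own steps as
  bounds. At \<open>h = 0\<close> the order of visits is unconstrained and every label is
  stable.\<close>

lemma staged_exists:
  assumes p: "path p" and V: "\<not> last p \<le> V" and "h \<le> length p - 1"
  shows "\<exists>Z x. staged p V h Z x \<and> (\<forall>i < length p - 1. Z i \<le> p ! i) \<and>
    (\<forall>l. h \<le> l \<and> l < length p - 1 \<longrightarrow> stable p V Z l)"
  using \<open>h \<le> length p - 1\<close>
proof (induction h rule: inc_induct)
  case base
  have "staged p V (length p - 1) (nth p) p" using p V by (auto simp: staged_def)
  then show ?case by auto
next
  case (step h)
  then obtain Z x where Z: "staged p V (Suc h) Z x" "\<And>i. i < length p - 1 \<Longrightarrow> Z i \<le> p ! i"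
    "\<And>l. Suc h \<le> l \<Longrightarrow> l < length p - 1 \<Longrightarrow> stable p V Z l"
    by blast
  obtain Z' y where Z': "staged p V h Z' y" "stable p V Z' h"
    "\<And>i. i \<le> h \<Longrightarrow> Z' i \<le> Z i" "\<And>i. h < i \<Longrightarrow> Z' i = Z i"
    using staged_descend[OF p _ Z(1,2)] step by auto
  have le: "Z' i \<le> Z i" for i using Z'(3,4)[of i] by (cases "i \<le> h") auto
  have "stable p V Z' l" if "h \<le> l" "l < length p - 1" for l
  proof (cases "l = h")
    case False
    then show ?thesis
      using that Z(3)[of l] le Z'(4) by (intro stable_antimono[of p V Z l Z']) auto
  qed (use Z'(2) in simp)
  then show ?case using Z'(1) Z(2) le by (meson order_trans)
qed

text \<open>Induction from the end of the word. For consecutive \<open>i\<close>, \<open>j\<close>,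
  let \<open>t\<close> be the largest label in range visited no later than \<open>j\<close>. All
  larger labels are visited later, so stability at \<open>t\<close> carries the continuation of
  \<open>j\<close> over to \<open>i\<close>.\<close>

lemma stable_reach:
  assumes p: "path p" and Z: "\<And>i. i < length p - 1 \<Longrightarrow> Z i \<le> p ! i"
    and st: "\<And>l. l < length p - 1 \<Longrightarrow> stable p V Z l"
    and s: "path s" "last s \<le> last p" "\<not> last s \<le> V"
    and k: "\<And>l. l < length p - 1 \<Longrightarrow> k l < length s \<and> s ! k l \<le> Z l"
    and \<sigma>: "sort_key k [m..<length p - 1] = \<tau> @ i # \<sigma>"
  shows "Z i \<le> reach p (i # \<sigma>)"
  using \<sigma>
proof (induction \<sigma> arbitrary: \<tau> i)
  case Nil
  then have "i \<in> set (sort_key k [m..<length p - 1])" by simp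
  then have "i < length p - 1" by simp
  then show ?case using reach_single[OF p] Z order_trans by blast
next
  case (Cons j \<sigma>)
  have IH: "Z j \<le> reach p (j # \<sigma>)" using Cons.IH[of "\<tau> @ [i]" j] Cons.prems by simp
  have "sorted (map k (\<tau> @ i # j # \<sigma>))" unfolding Cons.prems[symmetric] by simp
  then have kij: "k i \<le> k j" by (simp add: sorted_append)
  have "distinct (sort_key k [m..<length p - 1])" by simp
  then have dist: "distinct (i # j # \<sigma>)" unfolding Cons.prems by simp
  have "set (sort_key k [m..<length p - 1]) = {m..<length p - 1}" by simp
  then have set: "set (i # j # \<sigma>) \<subseteq> {m..<length p - 1}" unfolding Cons.prems by auto
  define L where "L = {l \<in> {m..<length p - 1}. k l \<le> k j}"
  \<comment> \<open>\<open>t\<close> is the last record up to the visit of \<open>j\<close>.\<close>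
  define t where "t = Max L"
  have L: "finite L" "i \<in> L" "j \<in> L" using set kij by (auto simp: L_def)
  then have t: "t \<in> L" "i \<le> t" "j \<le> t" by (auto simp: t_def intro: Max_in)
  have later: "k t \<le> k l" if "t < l" "l < length p - 1" for l
  proof -
    have "l \<notin> L" using that(1) L(1) by (metis Max_ge leD t_def)
    then show ?thesis using t(1) that by (auto simp: L_def)
  qed
  have "t < length p - 1" using t(1) by (simp add: L_def)
  show ?case
  proof (rule st[OF \<open>t < length p - 1\<close>, unfolded stable_def, rule_format, of s "k t" "k j"],
      intro conjI allI impI)
    show "k t \<le> k j" using t(1) by (simp add: L_def)
    show "k j < length s" using k set by auto
    show "s ! k t \<le> Z t" using k \<open>t < length p - 1\<close> by blast
    show "\<exists>k'\<ge>k t. k' < length s \<and> s ! k' \<le> Z l" if "t < l \<and> l < length p - 1" for l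
      using later k that by blast
    show "s ! k j \<le> reach p (j # \<sigma>)" using k[of j] IH set by (auto intro: order_trans)
  qed (use s t dist set in auto)
qed

section \<open>From weak covering to covering\<close>

lemma weakly_covers_covering_path:
  assumes B: "weakly_covers B U" and p: "path p" "last p \<le> U"
  shows "last p \<le> (SUP q\<in>{q. covering_path B p q}. last q)" (is "_ \<le> ?V")
proof (rule ccontr)
  assume V: "\<not> last p \<le> ?V"
  define N where "N = length p - 1"
  obtain Z x where x: "staged p ?V 0 Z x" and Z: "\<And>i. i < N \<Longrightarrow> Z i \<le> p ! i"
    and st: "\<And>l. l < N \<Longrightarrow> stable p ?V Z l"
    using staged_exists[OF p(1) V, of 0] unfolding N_def by auto
  have xU: "path x" "last x \<le> U" using x p(2) by (auto simp: staged_def)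
  \<comment> \<open>The covering is applied to \<open>x\<close> instead of \<open>p\<close>: a
    refinement of \<open>x\<close> visits every bound \<open>Z l\<close>, as stability
    demands.\<close>
  have "last x \<le> ?V"
  proof (rule weakly_covers_last_le[OF B xU], rule ccontr)
    fix s
    assume s: "path s" "refines s x" "inhabits s B" "last s \<le> last x" "\<not> last s \<le> ?V"
    have s': "last s \<le> last p" using s(4) x by (auto simp: staged_def)
    obtain b where b: "b < length s" "s ! b \<le> B" using s(3) by (auto simp: inhabits_def)
    have "\<exists>k<length s. s ! k \<le> Z l" if "l < N" for l
    proof -
      obtain y where "y \<in> set x" "y \<le> Z l"
        using x \<open>l < N\<close> by (auto simp: staged_def N_def inhabits_iff)
      then show ?thesis using s(2) unfolding refines_iff by (metis in_set_conv_nth order_trans)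
    qed
    then obtain k' where k': "\<And>l. l < N \<Longrightarrow> k' l < length s \<and> s ! k' l \<le> Z l" by metis
    \<comment> \<open>The last label, which ends every word, is assigned the endpoint of
      \<open>s\<close>.\<close>
    define k where "k = (\<lambda>l. if l < N then k' l else length s - 1)"
    have k: "k l < length s \<and> s ! k l \<le> Z l" if "l < N" for l using k' that by (simp add: k_def)
    have "\<exists>q. covering_path B p q \<and> last s \<le> last q"
    proof (rule covering_path_extending[OF p(1) s(1) b, of k])
      show "k l < length s" for l using k'[of l] path_not_Nil[OF s(1)] by (simp add: k_def)
      show "k (length p - 1) = length s - 1" by (simp add: k_def N_def)
      show "s ! k l \<le> p ! l" if "l < length p - 1" for l
        using k Z that unfolding N_def by (meson order_trans)
      show "s ! k (next_label p \<rho>) \<le> reach p \<rho>"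
        if \<rho>: "sort_key k [m..<length p - 1] = \<tau> @ \<rho>" for m \<tau> \<rho>
      proof (cases \<rho>)
        case Nil
        then show ?thesis
          using s' path_not_Nil[OF s(1)] by (simp add: k_def N_def last_conv_nth)
      next
        case (Cons i \<sigma>)
        have "i \<in> set (sort_key k [m..<length p - 1])" unfolding \<rho> Cons by simp
        then have "i < N" by (simp add: N_def)
        have "Z i \<le> reach p (i # \<sigma>)"
        proof (rule stable_reach[OF p(1) _ _ s(1) s' s(5)])
          show "sort_key k [m..<length p - 1] = \<tau> @ i # \<sigma>" using \<rho> Cons by simp
        qed (use Z st k in \<open>auto simp: N_def\<close>)
        then show ?thesis using k[OF \<open>i < N\<close>] Cons order_trans by auto
      qed
    qed (fact s')
    then show False using s(5) by (meson SUP_upper2 mem_Collect_eq)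
  qed
  then show False using x by (simp add: staged_def)
qed

lemma weakly_covers_Cov_past:
  assumes "weakly_covers B U" "B \<le> past U"
  shows "B \<in> Cov_past (\<unlhd>) U"
  unfolding Cov_past_def
proof (intro CollectI conjI allI impI)
  fix p assume p: "path p \<and> lands_in p U"
  have "(SUP q\<in>{q. covering_path B p q}. last q) = last p"
    using weakly_covers_covering_path[OF assms(1), of p] p
    by (intro antisym SUP_least) (auto simp: lands_in_def covering_path_def)
  then show "\<exists>Q. local_past_refinement (\<unlhd>) p Q \<and> (\<forall>q\<in>Q. inhabits q B)"
    by (intro exI[of _ "{q. covering_path B p q}"])
      (auto simp: local_past_refinement_def covering_path_def)
qed (fact assms(2))

lemma Cov_past_trans:
  assumes "B \<in> Cov_past (\<unlhd>) A" "A \<in> Cov_past (\<unlhd>) U"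
  shows "B \<in> Cov_past (\<unlhd>) U"
proof (rule weakly_covers_Cov_past)
  show "weakly_covers B U"
    using weakly_covers_trans Cov_past_weakly_covers assms by blast
  show "B \<le> past U" using assms past_trans by (auto simp: Cov_past_def)
qed

end

subsection \<open>Duality\<close>

text \<open>
  None of these equations may be used uninstantiated as rewrite rules together: the pattern
  \<open>\<lambda>x y. le y x\<close> matches every relation.
\<close>

lemma is_path_dual:
  "is_path (\<lambda>x y. le y x) (rev p) \<longleftrightarrow> is_path le p"
  unfolding is_path_iff successively_rev set_rev rev_is_Nil_conv ..

lemma ex_image_rev: "(\<exists>Q. P Q) \<longleftrightarrow> (\<exists>Q. P (rev ` Q))"
proof
  assume "\<exists>Q. P Q"
  then obtain Q where "P Q" ..
  then have "P (rev ` (rev ` Q))" by (simp add: image_image)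
  then show "\<exists>Q. P (rev ` Q)" ..
qed blast

lemma past_cone_dual: "past_cone (\<lambda>x y. le y x) = future_cone le"
  by (auto simp: past_cone_def future_cone_def)

lemma future_cone_dual: "future_cone (\<lambda>x y. le y x) = past_cone le"
  by (auto simp: past_cone_def future_cone_def)

text \<open>The recursion peels steps off the front, whereas reversing a path removes its first step
  from the back.\<close>

lemma past_restrict_snoc:
  assumes "p \<noteq> []"
  shows "past_restrict le (p @ [x]) W = past_restrict le p (inf (last p) (past_cone le W)) @ [W]"
  using assms
proof (induction p rule: induct_list012)
  case (3 x y ys)
  have "past_restrict le (y # ys) Z \<noteq> []" for Z
    by (metis length_past_restrict length_0_conv list.distinct(1))
  then show ?case using 3 by (simp add: Let_def)
qed (simp_all add: Let_def)

lemma past_restrict_dual: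
  "past_restrict (\<lambda>x y. le y x) (rev p) V = rev (future_restrict le p V)"
proof (induction p arbitrary: V rule: induct_list012)
  case (3 x y ys)
  then show ?case
    using past_restrict_snoc[of "rev (y # ys)" "\<lambda>x y. le y x" x V]
    by (simp add: past_cone_dual)
qed simp_all

lemma local_past_refinement_dual:
  "local_past_refinement (\<lambda>x y. le y x) (rev p) (rev ` Q) \<longleftrightarrow> local_future_refinement le p Q"
proof -
  show ?thesis
    by (auto simp: local_past_refinement_def local_future_refinement_def is_path_dual
      last_rev image_image past_restrict_dual refines_iff)
qed

text \<open>Reversal is a bijection on lists, so both quantifiers, over paths and over refinements,
  can be taken over reversed lists.\<close>

lemma Cov_past_dual: "Cov_past (\<lambda>x y. le y x) U = Cov_future le U"
proof -
  define E where "E A p \<longleftrightarrow> (\<exists>Q. local_past_refinement (\<lambda>x y. le y x) p Q \<and> (\<forall>q\<in>Q. inhabits q A))"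
    for A p
  have E: "E A (rev p) \<longleftrightarrow> (\<exists>Q. local_future_refinement le p Q \<and> (\<forall>q\<in>Q. inhabits q A))" for A p
  proof -
    have "E A (rev p) \<longleftrightarrow> (\<exists>Q. local_past_refinement (\<lambda>x y. le y x) (rev p) (rev ` Q) \<and>
        (\<forall>q\<in>rev ` Q. inhabits q A))"
      unfolding E_def by (rule ex_image_rev)
    then show ?thesis by (simp add: local_past_refinement_dual inhabits_iff)
  qed
  have "(\<forall>p. is_path (\<lambda>x y. le y x) p \<and> lands_in p U \<longrightarrow> E A p) \<longleftrightarrow>
      (\<forall>p. is_path (\<lambda>x y. le y x) (rev p) \<and> lands_in (rev p) U \<longrightarrow> E A (rev p))" for A
    by (metis rev_rev_ident)
  moreover have "lands_in (rev p) U \<longleftrightarrow> starts_in p U" if "is_path le p" for p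
    using that by (auto simp: lands_in_def starts_in_def last_rev is_path_iff)
  ultimately show ?thesis
    by (simp add: Cov_past_def Cov_future_def past_cone_dual is_path_dual E_def[symmetric] E
      cong: conj_cong)
qed

text \<open>Passing to the opposite order exchanges the two wedge axioms and the two cones.\<close>

lemma join_preserving_locale_dual:
  assumes "join_preserving_locale le"
  shows "join_preserving_locale (\<lambda>x y. le y x)"
proof -
  interpret join_preserving_locale le by fact
  show ?thesis
  proof
    show "le (Sup (snd ` R)) (Sup (fst ` R))" if "\<And>U V. (U, V) \<in> R \<Longrightarrow> le V U" for R
      using Sup_related[of "prod.swap ` R"] that by (auto simp: image_image)
    show "\<exists>U'. le U' U \<and> U' \<le> V'" if "U \<le> V" "le V' V" for U V V'
      using wedge_past[OF that(2,1)] by blast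
    show "\<exists>U. U \<le> V \<and> le U' U" if "le V' V" "U' \<le> V'" for V V' U'
      using wedge_future[OF that(2,1)] by blast
    show "U = bot \<and> V = bot" if "le bot U" "le V bot" for U V
      using empty_related[OF that(2,1)] by simp
    show "cones_preserve_joins (\<lambda>x y. le y x)"
      using preserve
      by (simp add: cones_preserve_joins_def past_cone_dual[of le] future_cone_dual[of le])
  qed (use refl trans in \<open>blast+\<close>)
qed

theorem proposition5p5:
  fixes le :: "'a::frame \<Rightarrow> 'a \<Rightarrow> bool" (infix "\<unlhd>" 50)
    and U A B W :: 'a
  assumes "parallel_ordered_locale (\<unlhd>)"
    and "cones_preserve_joins (\<unlhd>)"
  shows
    "(U \<in> Cov_past (\<unlhd>) U \<and> U \<in> Cov_future (\<unlhd>) U) \<and>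
     (past_cone (\<unlhd>) U \<in> Cov_past (\<unlhd>) U \<and> future_cone (\<unlhd>) U \<in> Cov_future (\<unlhd>) U) \<and>
     ((B \<in> Cov_past (\<unlhd>) A \<and> A \<in> Cov_past (\<unlhd>) U \<longrightarrow> B \<in> Cov_past (\<unlhd>) U) \<and>
      (B \<in> Cov_future (\<unlhd>) A \<and> A \<in> Cov_future (\<unlhd>) U \<longrightarrow> B \<in> Cov_future (\<unlhd>) U)) \<and>
     (A \<in> Cov_past (\<unlhd>) U \<and> W \<le> U \<longrightarrow> inf A (past_cone (\<unlhd>) W) \<in> Cov_past (\<unlhd>) W) \<and>
     (B \<in> Cov_future (\<unlhd>) U \<and> W \<le> U \<longrightarrow> inf B (future_cone (\<unlhd>) W) \<in> Cov_future (\<unlhd>) W) \<and>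
     ((A \<in> Cov_past (\<unlhd>) U \<longrightarrow> A \<unlhd> U) \<and> (B \<in> Cov_future (\<unlhd>) U \<longrightarrow> U \<unlhd> B)) \<and>
     (Cov_past (\<unlhd>) bot = {bot} \<and> Cov_future (\<unlhd>) bot = {bot})"
proof -
  have L: "join_preserving_locale (\<unlhd>)"
    using assms by (simp add: join_preserving_locale_def join_preserving_locale_axioms_def)
  interpret P: join_preserving_locale "(\<unlhd>)" by (rule L)
  \<comment> \<open>Past statements for the opposite order become, through \<open>dual\<close>, the
    future statements for the given one.\<close>
  interpret F: join_preserving_locale "\<lambda>x y. y \<unlhd> x" by (rule join_preserving_locale_dual[OF L])
  note dual = Cov_past_dual[of "(\<unlhd>)"] past_cone_dual[of "(\<unlhd>)"]
  show ?thesis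
    using P.Cov_past_between[of U U] P.Cov_past_between[of U "past_cone (\<unlhd>) U"]
      F.Cov_past_between[of U U, unfolded dual]
      F.Cov_past_between[of U "future_cone (\<unlhd>) U", unfolded dual]
      P.Cov_past_trans[of B A U] F.Cov_past_trans[of B A U, unfolded dual]
      P.Cov_past_restrict[of A U W] F.Cov_past_restrict[of B U W, unfolded dual]
      P.Cov_past_related[of A U] F.Cov_past_related[of B U, unfolded dual]
      P.Cov_past_bot F.Cov_past_bot[unfolded dual]
      P.past_increasing[of U] P.future_increasing[of U]
    by simp
qed

end
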